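(* There is an absolute constant $K>0$ such that the following holds. Consider a sequence of instances, indexed by $n\to\infty$, of the following data, all of which may depend on $n$: integers $m,p\ge1$; a set $\mathcal{B}=\{B_1,\ldots,B_p\}$ with each $B_j\in\mathbb{C}^{m\times n}$; a random vector $u=(u_1,\dots,u_n)$ that is either a Gaussian sequence or a Rademacher sequence; the matrix $L\in\mathbb{C}^{m\times p}$ whose $j$-th column is $B_ju$; $M=L^*L$, $N=\mathbb{E}M$, $\kappa=\kappa(\mathcal{B})<\infty$, $\lambda=\lambda(\mathcal{B})$; a matrix $$A=\sum_{j=1}^p d_jB_j+E\in\mathbb{C}^{m\times n},\qquad d_1,\dots,d_p\in\mathbb{C},\quad \|E\|\le\varepsilon;$$ and a number $0<t<1$. Assume that with high probability $$\|M-N\|\le\frac{t\|N\|}{\kappa}.$$ Let $c=(c_1,\dots,c_p)^T=L^{+}Au$ be the recovered coefficients. Then with high probability $$\left\|A-\sum_{j=1}^p c_jB_j\right\|\le K\,\varepsilon\,\lambda\left(\frac{\kappa p}{1-t}\right)^{1/2}.$$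
   Context: $\|\cdot\|$ is the spectral norm and $\|\cdot\|_F$ the Frobenius norm; $\langle A,B\rangle=\operatorname{tr}(A^*B)$ is the Frobenius inner product. $L^{+}$ is the Moore–Penrose pseudoinverse of $L$. A Gaussian sequence has i.i.d. real standard normal entries; a Rademacher sequence has i.i.d. entries equal to $\pm1$ with probability $1/2$ each. $\kappa(\mathcal{B})$ is the (spectral) condition number of the Gram matrix with entries $\langle B_j,B_k\rangle$, $1\le j,k\le p$; this Gram matrix equals $N=\mathbb{E}M$. For a nonzero matrix $A$ with $n$ columns, the weak condition number is $\lambda(A)=\|A\|\,n^{1/2}/\|A\|_F$, and $\lambda(\mathcal{B})=\max_{A\in\mathcal{B}}\lambda(A)$. "With high probability" means with probability tending to $1$ as $n\to\infty$. *)

theory Defs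
  imports
    "HOL-Probability.Probability"
    "Jordan_Normal_Form.Schur_Decomposition"
    "Jordan_Normal_Form.Gauss_Jordan_Elimination"
begin

(* HOL-Analysis uses the same symbol for components of type-indexed vectors. *)
unbundle no vec_syntax

section \<open>Matrix norms and related notions\<close>

definition vec_l2norm :: "complex Matrix.vec \<Rightarrow> real" where
  "vec_l2norm x = sqrt (\<Sum>i<dim_vec x. (cmod (x $ i))\<^sup>2)"

definition spectral_norm :: "complex Matrix.mat \<Rightarrow> real" where
  "spectral_norm A = (SUP x\<in>{x \<in> carrier_vec (dim_col A). vec_l2norm x \<le> 1}. vec_l2norm (A *\<^sub>v x))"

definition frobenius_norm :: "complex Matrix.mat \<Rightarrow> real" where
  "frobenius_norm A = sqrt (\<Sum>i<dim_row A. \<Sum>j<dim_col A. (cmod (A $$ (i, j)))\<^sup>2)"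

definition mat_trace :: "complex Matrix.mat \<Rightarrow> complex" where
  "mat_trace A = (\<Sum>i<dim_row A. A $$ (i, i))"

definition frobenius_inner :: "complex Matrix.mat \<Rightarrow> complex Matrix.mat \<Rightarrow> complex" where
  "frobenius_inner A B = mat_trace (mat_adjoint A * B)"

(* The four Penrose equations; they determine X uniquely, and a solution always exists. *)
definition is_pseudoinverse :: "complex Matrix.mat \<Rightarrow> complex Matrix.mat \<Rightarrow> bool" where
  "is_pseudoinverse L X \<longleftrightarrow>
     X \<in> carrier_mat (dim_col L) (dim_row L) \<and>
     L * X * L = L \<and>
     X * L * X = X \<and>
     mat_adjoint (L * X) = L * X \<and>
     mat_adjoint (X * L) = X * L"

definition pseudoinverse :: "complex Matrix.mat \<Rightarrow> complex Matrix.mat" where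
  "pseudoinverse L = (THE X. is_pseudoinverse L X)"

(* mat_inverse G is None exactly when the square matrix G is singular. *)
definition condition_number :: "complex Matrix.mat \<Rightarrow> ereal" where
  "condition_number G =
     (case mat_inverse G of
        Some H \<Rightarrow> ereal (spectral_norm G * spectral_norm H)
      | None \<Rightarrow> \<infinity>)"

definition weak_condition_number :: "complex Matrix.mat \<Rightarrow> real" where
  "weak_condition_number A = spectral_norm A * sqrt (real (dim_col A)) / frobenius_norm A"


section \<open>Families of matrices\<close>

(* A family B_1, ..., B_p of matrices is given by B 0, ..., B (p - 1). *)

definition lin_comb ::
    "nat \<Rightarrow> nat \<Rightarrow> nat \<Rightarrow> (nat \<Rightarrow> complex) \<Rightarrow> (nat \<Rightarrow> complex Matrix.mat) \<Rightarrow> complex Matrix.mat" where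
  "lin_comb m n p c B = Matrix.mat m n (\<lambda>(i, k). \<Sum>j<p. c j * B j $$ (i, k))"

definition gram_matrix :: "nat \<Rightarrow> (nat \<Rightarrow> complex Matrix.mat) \<Rightarrow> complex Matrix.mat" where
  "gram_matrix p B = Matrix.mat p p (\<lambda>(j, k). frobenius_inner (B j) (B k))"

definition family_condition_number :: "nat \<Rightarrow> (nat \<Rightarrow> complex Matrix.mat) \<Rightarrow> ereal" where
  "family_condition_number p B = condition_number (gram_matrix p B)"

definition family_weak_condition_number :: "nat \<Rightarrow> (nat \<Rightarrow> complex Matrix.mat) \<Rightarrow> real" where
  "family_weak_condition_number p B = Max ((\<lambda>j. weak_condition_number (B j)) ` {..<p})"


section \<open>Random vectors\<close>

(* The two measures below are the laws of the random vector u = (u 0, ..., u (n - 1)). *)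

definition gaussian_sequence :: "nat \<Rightarrow> (nat \<Rightarrow> real) measure" where
  "gaussian_sequence n = (\<Pi>\<^sub>M i\<in>{..<n}. density lborel (\<lambda>x. ennreal (std_normal_density x)))"

definition rademacher_sequence :: "nat \<Rightarrow> (nat \<Rightarrow> real) measure" where
  "rademacher_sequence n = (\<Pi>\<^sub>M i\<in>{..<n}. measure_pmf (pmf_of_set {-1, 1}))"

definition cvec_of :: "nat \<Rightarrow> (nat \<Rightarrow> real) \<Rightarrow> complex Matrix.vec" where
  "cvec_of n u = Matrix.vec n (\<lambda>i. complex_of_real (u i))"

(* The matrix L, whose columns are the vectors B_j u. *)
definition query_matrix ::
    "nat \<Rightarrow> nat \<Rightarrow> nat \<Rightarrow> (nat \<Rightarrow> complex Matrix.mat) \<Rightarrow> (nat \<Rightarrow> real) \<Rightarrow> complex Matrix.mat" where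
  "query_matrix m n p B u = mat_of_cols m (map (\<lambda>j. B j *\<^sub>v cvec_of n u) [0..<p])"

(* The matrix M = L^* L. *)
definition query_gram ::
    "nat \<Rightarrow> nat \<Rightarrow> nat \<Rightarrow> (nat \<Rightarrow> complex Matrix.mat) \<Rightarrow> (nat \<Rightarrow> real) \<Rightarrow> complex Matrix.mat" where
  "query_gram m n p B u = mat_adjoint (query_matrix m n p B u) * query_matrix m n p B u"

(* The entrywise expectation of a random r x s matrix X. *)
definition expected_mat ::
    "(nat \<Rightarrow> real) measure \<Rightarrow> nat \<Rightarrow> nat \<Rightarrow> ((nat \<Rightarrow> real) \<Rightarrow> complex Matrix.mat) \<Rightarrow> complex Matrix.mat" where
  "expected_mat P r s X = Matrix.mat r s (\<lambda>(j, k). \<integral>u. X u $$ (j, k) \<partial>P)"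

(* The vector c = L^+ A u. *)
definition recovered_coeffs ::
    "nat \<Rightarrow> nat \<Rightarrow> nat \<Rightarrow> (nat \<Rightarrow> complex Matrix.mat) \<Rightarrow> complex Matrix.mat \<Rightarrow> (nat \<Rightarrow> real) \<Rightarrow>
      complex Matrix.vec" where
  "recovered_coeffs m n p B A u =
     pseudoinverse (query_matrix m n p B u) *\<^sub>v (A *\<^sub>v cvec_of n u)"

(* In the style of almost-everywhere statements, Q n need not be a measurable event itself: it
   must contain measurable events whose probabilities tend to 1. *)
definition with_high_probability ::
    "(nat \<Rightarrow> 'a measure) \<Rightarrow> (nat \<Rightarrow> 'a \<Rightarrow> bool) \<Rightarrow> bool" where
  "with_high_probability P Q \<longleftrightarrow>
     (\<exists>F. (\<forall>n. F n \<in> sets (P n) \<and> (\<forall>u\<in>F n. Q n u)) \<and>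
          (\<lambda>n. measure (P n) (F n)) \<longlonglongrightarrow> 1)"

lemma with_high_probability_iff:
  assumes "\<And>n. prob_space (P n)" and "\<And>n. {u \<in> space (P n). Q n u} \<in> sets (P n)"
  shows "with_high_probability P Q \<longleftrightarrow> (\<lambda>n. \<P>(u in P n. Q n u)) \<longlonglongrightarrow> 1"
proof
  assume "with_high_probability P Q"
  then obtain F where F: "\<And>n. F n \<in> sets (P n)" "\<And>n u. u \<in> F n \<Longrightarrow> Q n u"
    and lim: "(\<lambda>n. measure (P n) (F n)) \<longlonglongrightarrow> 1"
    unfolding with_high_probability_def by blast
  have le: "measure (P n) (F n) \<le> \<P>(u in P n. Q n u)" for n
  proof -
    interpret prob_space "P n" by (rule assms(1))
    show ?thesis
      using F(2) sets.sets_into_space[OF F(1)[of n]] by (intro finite_measure_mono assms(2)) auto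
  qed
  have ge: "\<P>(u in P n. Q n u) \<le> 1" for n
    using prob_space.prob_le_1[OF assms(1)] .
  show "(\<lambda>n. \<P>(u in P n. Q n u)) \<longlonglongrightarrow> 1"
    by (rule tendsto_sandwich[OF _ _ lim tendsto_const]) (simp_all add: le ge)
next
  assume "(\<lambda>n. \<P>(u in P n. Q n u)) \<longlonglongrightarrow> 1"
  then show "with_high_probability P Q"
    unfolding with_high_probability_def
    by (intro exI[of _ "\<lambda>n. {u \<in> space (P n). Q n u}"]) (simp add: assms(2))
qed

end

(* On the event that the sum of the squares of u is at most 4 n, which is likely by Chebyshev's
   inequality, the bound is deterministic. The expectation N of M is the Gram matrix, so that
   <x, N x> is at least |x|^2 / |N^-1|, and the assumption on M - N yields
   |L x|^2 >= (1 - t) |x|^2 / |N^-1|. In particular L is injective and c = d + a with a = L^+ E u.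
   Since L L^+ is an orthogonal projection, |L a| <= |E u| <= 2 eps sqrt n, which bounds a; and
   |B_j| sqrt n <= lambda |B_j|_F <= lambda sqrt |N|. Cauchy-Schwarz over j then bounds the sum of the
   a_j B_j, and eps itself is absorbed because kappa and lambda are at least 1. *)

theory Submission
  imports Defs
begin

section \<open>Euclidean and spectral norms\<close>

text \<open>The matrix L is built from the same vector u to which it is applied in L^+ E u. No joint
  law of L and u has to be understood: E u is bounded crudely by |E| |u|, so randomness enters only
  through two events, the assumed one and the bound on |u|. Any threshold c n with c > 1 would do
  for the sum of squares; 4 has a rational square root. The condition number arises from two
  separate sources: sqrt |N^-1| comes with the coefficient error a, and sqrt |N| with the norms of
  the B_j. The factor sqrt n in |u| cancels against the one in the weak condition number.
  Eigenvalues never occur. N is factored as G^* G, where the columns of G are the vectorised B_j,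
  just as M = L^* L; the spectral facts about M and N then become Cauchy-Schwarz arguments for G x
  and L x.\<close>

lemma mult_mat_vec_index_sum:
  fixes A :: "'a :: comm_semiring_0 Matrix.mat"
  assumes "i < dim_row A" "dim_vec x = dim_col A"
  shows "(A *\<^sub>v x) $ i = (\<Sum>j<dim_col A. A $$ (i, j) * x $ j)"
  using assms by (simp add: scalar_prod_def lessThan_atLeast0)

lemma vec_l2norm_L2_set: "vec_l2norm x = L2_set (\<lambda>i. cmod (x $ i)) {..<dim_vec x}"
  by (simp add: vec_l2norm_def L2_set_def)

lemma vec_l2norm_nonneg [simp]: "0 \<le> vec_l2norm x"
  by (simp add: vec_l2norm_L2_set)

lemma vec_l2norm_power2: "(vec_l2norm x)\<^sup>2 = (\<Sum>i<dim_vec x. (cmod (x $ i))\<^sup>2)"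
  by (simp add: vec_l2norm_def sum_nonneg)

lemma vec_l2norm_zero [simp]: "vec_l2norm (0\<^sub>v n) = 0"
  by (simp add: vec_l2norm_def)

lemma vec_l2norm_eq_0_iff: "vec_l2norm x = 0 \<longleftrightarrow> x = 0\<^sub>v (dim_vec x)"
  by (auto simp: vec_l2norm_L2_set L2_set_eq_0_iff intro!: eq_vecI)
    (metis index_zero_vec(1))

lemma cmod_index_le_vec_l2norm: "i < dim_vec x \<Longrightarrow> cmod (x $ i) \<le> vec_l2norm x"
  unfolding vec_l2norm_L2_set by (rule member_le_L2_set) auto

lemma vec_l2norm_smult: "vec_l2norm (c \<cdot>\<^sub>v x) = cmod c * vec_l2norm x"
  unfolding vec_l2norm_L2_set L2_set_right_distrib[OF norm_ge_zero]
  by (rule L2_set_cong) (simp_all add: norm_mult)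

lemma vec_l2norm_unit_vec: "j < n \<Longrightarrow> vec_l2norm (unit_vec n j) = 1"
  by (simp add: vec_l2norm_def if_distrib[of cmod] if_distrib[of "\<lambda>x. x\<^sup>2"] cong: if_cong)

lemma vec_l2norm_triangle:
  assumes "dim_vec x = dim_vec y"
  shows "vec_l2norm (x + y) \<le> vec_l2norm x + vec_l2norm y"
proof -
  have "vec_l2norm (x + y) = L2_set (\<lambda>i. cmod (x $ i + y $ i)) {..<dim_vec y}"
    unfolding vec_l2norm_L2_set by (rule L2_set_cong) simp_all
  also have "\<dots> \<le> L2_set (\<lambda>i. cmod (x $ i) + cmod (y $ i)) {..<dim_vec y}"
    by (intro L2_set_mono norm_triangle_ineq) auto
  also have "\<dots> \<le> vec_l2norm x + vec_l2norm y"
    unfolding vec_l2norm_L2_set assms by (rule L2_set_triangle_ineq)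
  finally show ?thesis .
qed

lemma cscalar_prod_sum: "x \<bullet>c y = (\<Sum>i<dim_vec y. x $ i * cnj (y $ i))"
  by (simp add: scalar_prod_def lessThan_atLeast0)

lemma cscalar_prod_self: "x \<bullet>c x = complex_of_real ((vec_l2norm x)\<^sup>2)"
  by (simp only: cscalar_prod_sum vec_l2norm_power2 complex_norm_square of_real_sum)

lemma cscalar_prod_Cauchy_Schwarz:
  assumes "dim_vec x = dim_vec y"
  shows "cmod (x \<bullet>c y) \<le> vec_l2norm x * vec_l2norm y"
proof -
  have "cmod (x \<bullet>c y) \<le> (\<Sum>i<dim_vec y. \<bar>cmod (x $ i)\<bar> * \<bar>cmod (y $ i)\<bar>)"
    unfolding cscalar_prod_sum by (rule order_trans[OF norm_sum]) (simp add: norm_mult)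
  also have "\<dots> \<le> vec_l2norm x * vec_l2norm y"
    unfolding vec_l2norm_L2_set assms by (rule L2_set_mult_ineq)
  finally show ?thesis .
qed

section \<open>Adjoints and the quadratic form of an adjoint product\<close>

lemma mat_adjoint_carrier:
  "A \<in> carrier_mat m p \<Longrightarrow> mat_adjoint A \<in> carrier_mat p m"
  by (auto simp: mat_adjoint_def)

lemma mat_adjoint_index:
  fixes A :: "complex Matrix.mat"
  assumes "i < dim_row A" "j < dim_col A"
  shows "mat_adjoint A $$ (j, i) = cnj (A $$ (i, j))"
  using assms by (simp add: mat_adjoint_def mat_of_rows_index)

lemma mat_adjoint_cscalar_prod:
  fixes A :: "complex Matrix.mat"
  assumes A: "A \<in> carrier_mat m p" and x: "x \<in> carrier_vec m" and y: "y \<in> carrier_vec p"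
  shows "(mat_adjoint A *\<^sub>v x) \<bullet>c y = x \<bullet>c (A *\<^sub>v y)"
proof -
  have d: "mat_adjoint A \<in> carrier_mat p m"
    using A by (rule mat_adjoint_carrier)
  have l: "(mat_adjoint A *\<^sub>v x) $ j = (\<Sum>i<m. cnj (A $$ (i, j)) * x $ i)" if "j < p" for j
    using A x d that by (simp add: mult_mat_vec_index_sum mat_adjoint_index del: index_mult_mat_vec)
  have r: "cnj ((A *\<^sub>v y) $ i) = (\<Sum>j<p. cnj (A $$ (i, j)) * cnj (y $ j))" if "i < m" for i
    using A y that by (simp add: mult_mat_vec_index_sum del: index_mult_mat_vec)
  have "(mat_adjoint A *\<^sub>v x) \<bullet>c y = (\<Sum>j<p. (\<Sum>i<m. cnj (A $$ (i, j)) * x $ i) * cnj (y $ j))"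
    unfolding cscalar_prod_sum using y l by (simp del: index_mult_mat_vec)
  also have "\<dots> = (\<Sum>j<p. \<Sum>i<m. cnj (A $$ (i, j)) * x $ i * cnj (y $ j))"
    by (simp only: sum_distrib_right)
  also have "\<dots> = (\<Sum>i<m. \<Sum>j<p. cnj (A $$ (i, j)) * x $ i * cnj (y $ j))"
    by (rule sum.swap)
  also have "\<dots> = (\<Sum>i<m. x $ i * (\<Sum>j<p. cnj (A $$ (i, j)) * cnj (y $ j)))"
    by (simp add: sum_distrib_left ac_simps)
  also have "\<dots> = x \<bullet>c (A *\<^sub>v y)"
    unfolding cscalar_prod_sum using A r by (simp del: index_mult_mat_vec)
  finally show ?thesis .
qed

text \<open>The version with two different vectors serves \<open>adjoint_mult_lower_bound\<close>;
  its diagonal case identifies the quadratic form of M with |L x|^2.\<close>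

lemma adjoint_mult_cscalar_prod:
  fixes A :: "complex Matrix.mat"
  assumes A: "A \<in> carrier_mat m p" and x: "x \<in> carrier_vec p" and y: "y \<in> carrier_vec p"
  shows "((mat_adjoint A * A) *\<^sub>v x) \<bullet>c y = (A *\<^sub>v x) \<bullet>c (A *\<^sub>v y)"
  unfolding assoc_mult_mat_vec[OF mat_adjoint_carrier[OF A] A x]
  by (rule mat_adjoint_cscalar_prod[OF A mult_mat_vec_carrier[OF A x] y])

lemma adjoint_mult_cscalar_prod_self:
  assumes "A \<in> carrier_mat m p" "x \<in> carrier_vec p"
  shows "((mat_adjoint A * A) *\<^sub>v x) \<bullet>c x = complex_of_real ((vec_l2norm (A *\<^sub>v x))\<^sup>2)"
  using adjoint_mult_cscalar_prod[OF assms(1,2,2)] unfolding cscalar_prod_self .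

section \<open>Frobenius norm, spectral norm and their comparison\<close>

lemma frobenius_norm_nonneg [simp]: "0 \<le> frobenius_norm A"
  by (simp add: frobenius_norm_def sum_nonneg)

lemma vec_l2norm_mult_le_frobenius:
  assumes "dim_vec x = dim_col A"
  shows "vec_l2norm (A *\<^sub>v x) \<le> frobenius_norm A * vec_l2norm x"
proof (rule power2_le_imp_le)
  have row: "(cmod ((A *\<^sub>v x) $ i))\<^sup>2 \<le> (\<Sum>j<dim_col A. (cmod (A $$ (i, j)))\<^sup>2) * (vec_l2norm x)\<^sup>2"
    if "i < dim_row A" for i
  proof -
    have "cmod ((A *\<^sub>v x) $ i) \<le> (\<Sum>j<dim_col A. \<bar>cmod (A $$ (i, j))\<bar> * \<bar>cmod (x $ j)\<bar>)"
      unfolding mult_mat_vec_index_sum[OF that assms]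
      by (rule order_trans[OF norm_sum]) (simp add: norm_mult)
    also have "\<dots> \<le> L2_set (\<lambda>j. cmod (A $$ (i, j))) {..<dim_col A} * vec_l2norm x"
      unfolding vec_l2norm_L2_set assms by (rule L2_set_mult_ineq)
    finally have "(cmod ((A *\<^sub>v x) $ i))\<^sup>2
        \<le> (L2_set (\<lambda>j. cmod (A $$ (i, j))) {..<dim_col A} * vec_l2norm x)\<^sup>2"
      by (rule power_mono) simp
    then show ?thesis
      by (simp add: power_mult_distrib L2_set_def sum_nonneg)
  qed
  have "(vec_l2norm (A *\<^sub>v x))\<^sup>2
      \<le> (\<Sum>i<dim_row A. (\<Sum>j<dim_col A. (cmod (A $$ (i, j)))\<^sup>2) * (vec_l2norm x)\<^sup>2)"
    unfolding vec_l2norm_power2[of "A *\<^sub>v x"] using sum_mono[OF row, of "{..<dim_row A}" "\<lambda>i. i"] by simp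
  also have "\<dots> = (frobenius_norm A * vec_l2norm x)\<^sup>2"
    by (simp add: frobenius_norm_def power_mult_distrib sum_distrib_right sum_nonneg)
  finally show "(vec_l2norm (A *\<^sub>v x))\<^sup>2 \<le> (frobenius_norm A * vec_l2norm x)\<^sup>2" .
qed simp

text \<open>A supremum of reals dominates the members of the set only if the set is bounded above,
  so each lower estimate of \<open>spectral_norm\<close> passes through this fact. The Frobenius
  norm is a convenient bound.\<close>

lemma spectral_norm_bdd:
  "bdd_above ((\<lambda>x. vec_l2norm (A *\<^sub>v x)) ` {x \<in> carrier_vec (dim_col A). vec_l2norm x \<le> 1})"
proof (rule bdd_aboveI2)
  fix x assume "x \<in> {x \<in> carrier_vec (dim_col A). vec_l2norm x \<le> 1}"
  then show "vec_l2norm (A *\<^sub>v x) \<le> frobenius_norm A"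
    using vec_l2norm_mult_le_frobenius[of x A]
      mult_left_le[of "vec_l2norm x" "frobenius_norm A"] by auto
qed

lemma spectral_norm_nonneg [simp]: "0 \<le> spectral_norm A"
proof -
  have "vec_l2norm (A *\<^sub>v 0\<^sub>v (dim_col A)) \<le> spectral_norm A"
    unfolding spectral_norm_def by (rule cSUP_upper[OF _ spectral_norm_bdd]) simp
  then show ?thesis
    using vec_l2norm_nonneg order_trans by blast
qed

lemma vec_l2norm_mult_le_spectral:
  assumes "dim_vec x = dim_col A"
  shows "vec_l2norm (A *\<^sub>v x) \<le> spectral_norm A * vec_l2norm x"
proof (cases "vec_l2norm x = 0")
  \<comment> \<open>Normalisation is impossible here, but the Frobenius bound forces the left side
    to vanish.\<close>
  case True
  then show ?thesis
    using vec_l2norm_mult_le_frobenius[OF assms] by simp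
next
  case False
  define r where "r = vec_l2norm x"
  have r: "r > 0"
    using False vec_l2norm_nonneg[of x] unfolding r_def by linarith
  define y where "y = complex_of_real (1 / r) \<cdot>\<^sub>v x"
  have y: "y \<in> carrier_vec (dim_col A)"
    unfolding y_def by (rule carrier_vecI) (simp add: assms)
  have y1: "vec_l2norm y = 1"
    using r unfolding y_def vec_l2norm_smult r_def[symmetric] by (simp add: norm_divide)
  have x: "x = complex_of_real r \<cdot>\<^sub>v y"
    using r unfolding y_def smult_smult_assoc by simp
  have "A *\<^sub>v x = complex_of_real r \<cdot>\<^sub>v (A *\<^sub>v y)"
    by (subst x) (rule mult_mat_vec[OF carrier_matI[OF refl refl] y])
  then have "vec_l2norm (A *\<^sub>v x) = r * vec_l2norm (A *\<^sub>v y)"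
    using r by (simp add: vec_l2norm_smult)
  also have "vec_l2norm (A *\<^sub>v y) \<le> spectral_norm A"
    unfolding spectral_norm_def by (rule cSUP_upper[OF _ spectral_norm_bdd]) (simp add: y y1)
  finally show ?thesis
    using r by (simp add: r_def mult.commute)
qed

lemma spectral_norm_leI:
  assumes "0 \<le> c"
    and "\<And>x. x \<in> carrier_vec (dim_col A) \<Longrightarrow> vec_l2norm (A *\<^sub>v x) \<le> c * vec_l2norm x"
  shows "spectral_norm A \<le> c"
  unfolding spectral_norm_def
proof (rule cSUP_least)
  show "{x \<in> carrier_vec (dim_col A). vec_l2norm x \<le> 1} \<noteq> {}"
    by (auto intro!: exI[of _ "0\<^sub>v (dim_col A)"])
next
  fix x assume "x \<in> {x \<in> carrier_vec (dim_col A). vec_l2norm x \<le> 1}"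
  then show "vec_l2norm (A *\<^sub>v x) \<le> c"
    using assms(2)[of x] mult_left_le[of "vec_l2norm x" c] assms(1) by auto
qed

text \<open>An entry is a coordinate of the image of a unit vector. The use is on the diagonal of
  the Gram matrix, which carries the squared Frobenius norms of the family.\<close>

lemma cmod_entry_le_spectral_norm:
  assumes "i < dim_row A" "j < dim_col A"
  shows "cmod (A $$ (i, j)) \<le> spectral_norm A"
proof -
  have "cmod (A $$ (i, j)) = cmod ((A *\<^sub>v unit_vec (dim_col A) j) $ i)"
    using assms by simp
  also have "\<dots> \<le> vec_l2norm (A *\<^sub>v unit_vec (dim_col A) j)"
    using assms by (intro cmod_index_le_vec_l2norm) simp
  also have "\<dots> \<le> spectral_norm A"
    using vec_l2norm_mult_le_spectral[of "unit_vec (dim_col A) j" A] assms(2)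
    by (simp add: vec_l2norm_unit_vec)
  finally show ?thesis .
qed

text \<open>Each column is the image of a unit vector, hence no longer than the spectral norm; the
  squares are summed over the columns. This is why weak condition numbers of nonzero matrices are at
  least 1.\<close>

lemma frobenius_norm_le_spectral: "frobenius_norm A \<le> sqrt (dim_col A) * spectral_norm A"
proof -
  have col: "(\<Sum>i<dim_row A. (cmod (A $$ (i, j)))\<^sup>2) \<le> (spectral_norm A)\<^sup>2" if j: "j < dim_col A" for j
  proof -
    have "(\<Sum>i<dim_row A. (cmod (A $$ (i, j)))\<^sup>2) = (vec_l2norm (A *\<^sub>v unit_vec (dim_col A) j))\<^sup>2"
      using j by (simp add: vec_l2norm_power2)
    also have "\<dots> \<le> (spectral_norm A)\<^sup>2"
      using vec_l2norm_mult_le_spectral[of "unit_vec (dim_col A) j" A] j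
      by (intro power_mono) (simp_all add: vec_l2norm_unit_vec)
    finally show ?thesis .
  qed
  have "(\<Sum>i<dim_row A. \<Sum>j<dim_col A. (cmod (A $$ (i, j)))\<^sup>2)
      = (\<Sum>j<dim_col A. \<Sum>i<dim_row A. (cmod (A $$ (i, j)))\<^sup>2)"
    by (rule sum.swap)
  also have "\<dots> \<le> real (dim_col A) * (spectral_norm A)\<^sup>2"
    using sum_bounded_above[of "{..<dim_col A}" _ "(spectral_norm A)\<^sup>2"] col by simp
  finally show ?thesis
    unfolding frobenius_norm_def by (simp add: real_le_lsqrt sum_nonneg power_mult_distrib)
qed

section \<open>Pseudoinverse of an injective matrix\<close>

lemma mat_adjoint_dim [simp]:
  "dim_row (mat_adjoint A) = dim_col A" "dim_col (mat_adjoint A) = dim_row A"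
  by (simp_all add: mat_adjoint_def)

lemma mat_adjoint_adjoint: "mat_adjoint (mat_adjoint A) = (A :: complex Matrix.mat)"
  by (rule eq_matI) (simp_all add: mat_adjoint_index)

lemma mat_adjoint_mult:
  fixes A B :: "complex Matrix.mat"
  assumes "dim_col A = dim_row B"
  shows "mat_adjoint (A * B) = mat_adjoint B * mat_adjoint A"
  using assms
  by (intro eq_matI)
    (simp_all add: mat_adjoint_index scalar_prod_def cnj_sum mult.commute)

lemma mat_adjoint_one: "mat_adjoint (1\<^sub>m n) = (1\<^sub>m n :: complex Matrix.mat)"
  by (rule eq_matI) (auto simp: mat_adjoint_index)

text \<open>\<open>pseudoinverse\<close> is a definite description, so existence and uniqueness are
  both at stake. With X = H L^*, the identity X L = 1 settles every Penrose equation except the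
  self-adjointness of L X. That one holds because H, as the inverse of a self-adjoint matrix, is
  itself self-adjoint.\<close>

lemma pseudoinverse_injective:
  assumes L: "L \<in> carrier_mat m p" and H: "H \<in> carrier_mat p p"
    and HM: "H * (mat_adjoint L * L) = 1\<^sub>m p"
  shows "pseudoinverse L = H * mat_adjoint L"
proof -
  define L' where "L' = mat_adjoint L"
  define M where "M = L' * L"
  define X where "X = H * L'"
  have L': "L' \<in> carrier_mat p m"
    using L by (simp add: L'_def mat_adjoint_carrier)
  have M: "M \<in> carrier_mat p p" and X: "X \<in> carrier_mat p m"
    using L L' H by (auto simp: M_def X_def)
  have HM: "H * M = 1\<^sub>m p"
    using HM by (simp add: M_def L'_def)
  then have MH: "M * H = 1\<^sub>m p"
    using mat_mult_left_right_inverse[OF H M] by simp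
  have XL: "X * L = 1\<^sub>m p"
    using HM assoc_mult_mat[OF H L' L] by (simp add: X_def M_def)
  have adj_M: "mat_adjoint M = M"
    using L by (simp add: M_def L'_def mat_adjoint_mult mat_adjoint_adjoint)
  have H': "mat_adjoint H \<in> carrier_mat p p"
    using H by (rule mat_adjoint_carrier)
  have "M * mat_adjoint H = 1\<^sub>m p"
    using arg_cong[OF HM, of mat_adjoint] H M by (simp add: mat_adjoint_mult mat_adjoint_one adj_M)
  then have adj_H: "mat_adjoint H = H"
    using assoc_mult_mat[OF H M H'] HM H H' by simp
  have LX: "mat_adjoint (L * X) = L * X"
    using L H L' assoc_mult_mat[OF L H L']
    by (simp add: X_def L'_def mat_adjoint_mult mat_adjoint_adjoint adj_H)
  have "is_pseudoinverse L X"
    unfolding is_pseudoinverse_def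
    using L X assoc_mult_mat[OF L X L] by (simp add: XL LX mat_adjoint_one)
  moreover have "Y = X" if "is_pseudoinverse L Y" for Y
  proof -
    have Y: "Y \<in> carrier_mat p m" and LYL: "L * Y * L = L" and LY: "mat_adjoint (L * Y) = L * Y"
      using that L by (auto simp: is_pseudoinverse_def)
    \<comment> \<open>Taking the adjoint of \<open>L * Y * L = L\<close>, with \<open>L * Y\<close>
      self-adjoint, gives the normal equation \<open>M * Y = L'\<close>, which the invertible
      \<open>M\<close> solves uniquely.\<close>
    have "L' * (L * Y) = mat_adjoint (L * Y * L)"
      using L Y by (subst mat_adjoint_mult) (simp_all add: LY L'_def)
    then have "M * Y = L'"
      using assoc_mult_mat[OF L' L Y] by (simp add: LYL L'_def M_def)
    then show ?thesis
      using assoc_mult_mat[OF H M Y] Y by (simp add: HM X_def)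
  qed
  ultimately show ?thesis
    unfolding pseudoinverse_def X_def[symmetric] L'_def[symmetric] by (rule the_equality)
qed

section \<open>Spectral norms of sums and inverses, and lower bounds for adjoint products\<close>

lemma spectral_norm_triangle:
  assumes A: "A \<in> carrier_mat m n" and B: "B \<in> carrier_mat m n"
  shows "spectral_norm (A + B) \<le> spectral_norm A + spectral_norm B"
proof (rule spectral_norm_leI)
  fix x :: "complex Matrix.vec" assume "x \<in> carrier_vec (dim_col (A + B))"
  then have x: "x \<in> carrier_vec n"
    using B by simp
  have "vec_l2norm ((A + B) *\<^sub>v x) = vec_l2norm (A *\<^sub>v x + B *\<^sub>v x)"
    using add_mult_distrib_mat_vec[OF A B x] by simp
  also have "\<dots> \<le> vec_l2norm (A *\<^sub>v x) + vec_l2norm (B *\<^sub>v x)"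
    using A B by (intro vec_l2norm_triangle) simp
  also have "\<dots> \<le> spectral_norm A * vec_l2norm x + spectral_norm B * vec_l2norm x"
    using A B x by (intro add_mono vec_l2norm_mult_le_spectral) simp_all
  finally show "vec_l2norm ((A + B) *\<^sub>v x) \<le> (spectral_norm A + spectral_norm B) * vec_l2norm x"
    by (simp add: distrib_right)
qed simp

lemma spectral_norm_smult_le: "spectral_norm (c \<cdot>\<^sub>m A) \<le> cmod c * spectral_norm A"
proof (rule spectral_norm_leI)
  fix x :: "complex Matrix.vec" assume "x \<in> carrier_vec (dim_col (c \<cdot>\<^sub>m A))"
  then have x: "x \<in> carrier_vec (dim_col A)"
    by simp
  have "(c \<cdot>\<^sub>m A) *\<^sub>v x = c \<cdot>\<^sub>v (A *\<^sub>v x)"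
    using x by (intro eq_vecI) (simp_all add: scalar_prod_def sum_distrib_left mult.assoc)
  then have "vec_l2norm ((c \<cdot>\<^sub>m A) *\<^sub>v x) = cmod c * vec_l2norm (A *\<^sub>v x)"
    by (simp only: vec_l2norm_smult)
  also have "\<dots> \<le> cmod c * (spectral_norm A * vec_l2norm x)"
    using x by (intro mult_left_mono vec_l2norm_mult_le_spectral) simp_all
  finally show "vec_l2norm ((c \<cdot>\<^sub>m A) *\<^sub>v x) \<le> cmod c * spectral_norm A * vec_l2norm x"
    by (simp add: mult.assoc)
qed simp

lemma spectral_norm_le_frobenius: "spectral_norm A \<le> frobenius_norm A"
  by (rule spectral_norm_leI) (auto intro: vec_l2norm_mult_le_frobenius)

text \<open>The product fixes a unit vector, which exists because p >= 1. For the Gram matrix this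
  says that the condition number is at least 1, and so that both of its factors are
  positive.\<close>

lemma spectral_norm_mult_inverse_ge_1:
  assumes A: "A \<in> carrier_mat p p" and B: "B \<in> carrier_mat p p" and AB: "A * B = 1\<^sub>m p"
    and p: "p \<ge> 1"
  shows "1 \<le> spectral_norm A * spectral_norm B"
proof -
  define x :: "complex Matrix.vec" where "x = unit_vec p 0"
  have x: "x \<in> carrier_vec p"
    by (simp add: x_def)
  have x1: "vec_l2norm x = 1"
    using p by (simp add: x_def vec_l2norm_unit_vec)
  have "1 = vec_l2norm (A *\<^sub>v (B *\<^sub>v x))"
    using assoc_mult_mat_vec[OF A B x] AB x by (simp add: x1)
  also have "\<dots> \<le> spectral_norm A * vec_l2norm (B *\<^sub>v x)"
    using A B x by (intro vec_l2norm_mult_le_spectral) simp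
  also have "\<dots> \<le> spectral_norm A * spectral_norm B"
    using vec_l2norm_mult_le_spectral[of x B] B x by (intro mult_left_mono) (simp_all add: x1)
  finally show ?thesis .
qed

text \<open>For N = G^* G this is the bound of <N x, x> = |G x|^2 by the smallest eigenvalue 1 /
  |H|. With y = H x one has <G y, G x> = <N y, x> = |x|^2, while |G y|^2 = <x, y> is at most |H|
  |x|^2; Cauchy-Schwarz for G y and G x connects the two.\<close>

lemma adjoint_mult_lower_bound:
  assumes G: "G \<in> carrier_mat q p" and H: "H \<in> carrier_mat p p"
    and NH: "(mat_adjoint G * G) * H = 1\<^sub>m p" and x: "x \<in> carrier_vec p"
  shows "(vec_l2norm x)\<^sup>2 \<le> spectral_norm H * (vec_l2norm (G *\<^sub>v x))\<^sup>2"
proof (cases "vec_l2norm x = 0")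
  case False
  define N where "N = mat_adjoint G * G"
  define y where "y = H *\<^sub>v x"
  have N: "N \<in> carrier_mat p p"
    using G by (auto simp: N_def intro!: carrier_matI)
  have y: "y \<in> carrier_vec p"
    using H x by (simp add: y_def)
  have Ny: "N *\<^sub>v y = x"
    using assoc_mult_mat_vec[OF N H x] NH x by (simp add: N_def y_def)
  have "complex_of_real ((vec_l2norm x)\<^sup>2) = (G *\<^sub>v y) \<bullet>c (G *\<^sub>v x)"
    using adjoint_mult_cscalar_prod[OF G y x] by (simp only: N_def[symmetric] Ny cscalar_prod_self)
  then have "cmod (complex_of_real ((vec_l2norm x)\<^sup>2)) \<le> vec_l2norm (G *\<^sub>v y) * vec_l2norm (G *\<^sub>v x)"
    by (simp only: cscalar_prod_Cauchy_Schwarz dim_mult_mat_vec)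
  then have 1: "(vec_l2norm x)\<^sup>2 \<le> vec_l2norm (G *\<^sub>v y) * vec_l2norm (G *\<^sub>v x)"
    by (simp only: norm_of_real abs_power2)
  have "complex_of_real ((vec_l2norm (G *\<^sub>v y))\<^sup>2) = x \<bullet>c y"
    using adjoint_mult_cscalar_prod_self[OF G y] by (simp only: N_def[symmetric] Ny)
  then have "cmod (complex_of_real ((vec_l2norm (G *\<^sub>v y))\<^sup>2)) \<le> vec_l2norm x * vec_l2norm y"
    using cscalar_prod_Cauchy_Schwarz[of x y] x y by simp
  also have "\<dots> \<le> vec_l2norm x * (spectral_norm H * vec_l2norm x)"
    unfolding y_def using H x by (intro mult_left_mono vec_l2norm_mult_le_spectral) simp_all
  finally have 2: "(vec_l2norm (G *\<^sub>v y))\<^sup>2 \<le> spectral_norm H * (vec_l2norm x)\<^sup>2"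
    by (simp only: norm_of_real abs_power2) (simp add: power2_eq_square mult_ac)
  \<comment> \<open>Squaring \<open>1\<close> and inserting \<open>2\<close> leaves a surplus factor
    |x|^2 on both sides; its cancellation is the reason for the case distinction.\<close>
  have "(vec_l2norm x)\<^sup>2 * (vec_l2norm x)\<^sup>2
      \<le> (vec_l2norm (G *\<^sub>v y) * vec_l2norm (G *\<^sub>v x)) * (vec_l2norm (G *\<^sub>v y) * vec_l2norm (G *\<^sub>v x))"
    by (intro mult_mono 1) simp_all
  also have "\<dots> = (vec_l2norm (G *\<^sub>v y))\<^sup>2 * (vec_l2norm (G *\<^sub>v x))\<^sup>2"
    by (simp only: power2_eq_square mult_ac)
  also have "\<dots> \<le> (spectral_norm H * (vec_l2norm x)\<^sup>2) * (vec_l2norm (G *\<^sub>v x))\<^sup>2"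
    by (intro mult_right_mono 2) simp
  finally have "(vec_l2norm x)\<^sup>2 * (vec_l2norm x)\<^sup>2
      \<le> (vec_l2norm x)\<^sup>2 * (spectral_norm H * (vec_l2norm (G *\<^sub>v x))\<^sup>2)"
    by (simp only: mult_ac)
  moreover have "(vec_l2norm x)\<^sup>2 > 0"
    using False by simp
  ultimately show ?thesis
    by (simp only: mult_le_cancel_left_pos)
qed simp

text \<open>The quadratic forms |L x|^2 and |G x|^2 differ by at most |M - N| |x|^2. After
  multiplication by |H| this costs at most t |x|^2 of the unperturbed bound.\<close>

lemma adjoint_mult_lower_bound_perturbed:
  assumes G: "G \<in> carrier_mat q p" and H: "H \<in> carrier_mat p p"
    and NH: "(mat_adjoint G * G) * H = 1\<^sub>m p" and L: "L \<in> carrier_mat m p"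
    and dev: "spectral_norm (mat_adjoint L * L - mat_adjoint G * G) * spectral_norm H \<le> t"
    and x: "x \<in> carrier_vec p"
  shows "(1 - t) * (vec_l2norm x)\<^sup>2 \<le> spectral_norm H * (vec_l2norm (L *\<^sub>v x))\<^sup>2"
proof -
  define N where "N = mat_adjoint G * G"
  define M where "M = mat_adjoint L * L"
  have N: "N \<in> carrier_mat p p" and M: "M \<in> carrier_mat p p"
    using G L by (auto simp: N_def M_def intro!: carrier_matI)
  have "((M - N) *\<^sub>v x) \<bullet>c x = (M *\<^sub>v x - N *\<^sub>v x) \<bullet>c x"
    using minus_mult_distrib_mat_vec[OF M N x] by simp
  also have "\<dots> = (M *\<^sub>v x) \<bullet>c x - (N *\<^sub>v x) \<bullet>c x"
    using M N x by (intro minus_scalar_prod_distrib[of _ p]) auto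
  also have "\<dots> = complex_of_real ((vec_l2norm (L *\<^sub>v x))\<^sup>2 - (vec_l2norm (G *\<^sub>v x))\<^sup>2)"
    unfolding M_def N_def adjoint_mult_cscalar_prod_self[OF L x] adjoint_mult_cscalar_prod_self[OF G x]
    by simp
  finally have "\<bar>(vec_l2norm (L *\<^sub>v x))\<^sup>2 - (vec_l2norm (G *\<^sub>v x))\<^sup>2\<bar> = cmod (((M - N) *\<^sub>v x) \<bullet>c x)"
    by (simp only: norm_of_real)
  also have "\<dots> \<le> vec_l2norm ((M - N) *\<^sub>v x) * vec_l2norm x"
    using N x by (intro cscalar_prod_Cauchy_Schwarz) simp
  also have "\<dots> \<le> (spectral_norm (M - N) * vec_l2norm x) * vec_l2norm x"
    using N x by (intro mult_right_mono vec_l2norm_mult_le_spectral) simp_all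
  finally have diff: "(vec_l2norm (G *\<^sub>v x))\<^sup>2
      \<le> (vec_l2norm (L *\<^sub>v x))\<^sup>2 + spectral_norm (M - N) * (vec_l2norm x)\<^sup>2"
    by (simp only: power2_eq_square mult_ac)
  have "(vec_l2norm x)\<^sup>2 \<le> spectral_norm H * (vec_l2norm (G *\<^sub>v x))\<^sup>2"
    by (rule adjoint_mult_lower_bound[OF G H NH x])
  also have "\<dots> \<le> spectral_norm H * ((vec_l2norm (L *\<^sub>v x))\<^sup>2 + spectral_norm (M - N) * (vec_l2norm x)\<^sup>2)"
    by (intro mult_left_mono diff) simp
  also have "\<dots> = spectral_norm H * (vec_l2norm (L *\<^sub>v x))\<^sup>2
      + (spectral_norm (M - N) * spectral_norm H) * (vec_l2norm x)\<^sup>2"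
    by (simp add: algebra_simps)
  also have "\<dots> \<le> spectral_norm H * (vec_l2norm (L *\<^sub>v x))\<^sup>2 + t * (vec_l2norm x)\<^sup>2"
    using dev unfolding M_def N_def by (intro add_mono mult_right_mono) simp_all
  finally show ?thesis
    by (simp add: algebra_simps)
qed

text \<open>A kernel vector v of M = L^* L satisfies |L v|^2 = <M v, v> = 0, so injectivity of L
  makes M invertible and the explicit formula for the pseudoinverse applies.\<close>

lemma pseudoinverse_least_squares:
  assumes L: "L \<in> carrier_mat m p"
    and inj: "\<And>x. x \<in> carrier_vec p \<Longrightarrow> vec_l2norm (L *\<^sub>v x) = 0 \<Longrightarrow> x = 0\<^sub>v p"
  shows "pseudoinverse L \<in> carrier_mat p m" and "pseudoinverse L * L = 1\<^sub>m p"
    and "\<And>y. y \<in> carrier_vec m \<Longrightarrow> vec_l2norm (L *\<^sub>v (pseudoinverse L *\<^sub>v y)) \<le> vec_l2norm y"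
proof -
  define L' where "L' = mat_adjoint L"
  define M where "M = L' * L"
  have L': "L' \<in> carrier_mat p m"
    using L by (simp add: L'_def mat_adjoint_carrier)
  have M: "M \<in> carrier_mat p p"
    using L L' by (simp add: M_def)
  have "det M \<noteq> 0"
  proof
    assume "det M = 0"
    then obtain v where v: "v \<in> carrier_vec p" "v \<noteq> 0\<^sub>v p" "M *\<^sub>v v = 0\<^sub>v p"
      using det_0_iff_vec_prod_zero[OF M] by blast
    have "complex_of_real ((vec_l2norm (L *\<^sub>v v))\<^sup>2) = 0\<^sub>v p \<bullet>c v"
      using adjoint_mult_cscalar_prod_self[OF L v(1)] v(3) by (simp only: M_def L'_def)
    also have "\<dots> = 0"
      using v(1) by simp
    finally show False
      using inj[OF v(1)] v(2) by simp
  qed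
  then obtain H where H: "H \<in> carrier_mat p p" and HM: "H * M = 1\<^sub>m p"
    using det_non_zero_imp_unit[OF M, of "()"] by (auto simp: Units_def ring_mat_def)
  define X where "X = pseudoinverse L"
  have XH: "X = H * L'"
    unfolding X_def L'_def by (rule pseudoinverse_injective[OF L H]) (use HM in \<open>simp add: M_def L'_def\<close>)
  have X: "X \<in> carrier_mat p m"
    using H L' by (simp add: XH)
  show "pseudoinverse L \<in> carrier_mat p m"
    using X by (simp add: X_def)
  have XL: "X * L = 1\<^sub>m p"
    using HM assoc_mult_mat[OF H L' L] by (simp add: XH M_def)
  then show "pseudoinverse L * L = 1\<^sub>m p"
    by (simp add: X_def)
  have MH: "M * H = 1\<^sub>m p"
    using mat_mult_left_right_inverse[OF H M HM] .
  have MX: "M * X = L'"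
    using assoc_mult_mat[OF M H L'] MH L' by (simp add: XH)
  fix y :: "complex Matrix.vec" assume y: "y \<in> carrier_vec m"
  have Xy: "X *\<^sub>v y \<in> carrier_vec p"
    using X y by simp
  \<comment> \<open>The normal equation \<open>M * X = L'\<close> turns |L X y|^2 into the inner
    product of y with L X y. Cauchy-Schwarz then leaves one factor |L X y| to cancel.\<close>
  have "complex_of_real ((vec_l2norm (L *\<^sub>v (X *\<^sub>v y)))\<^sup>2) = (M *\<^sub>v (X *\<^sub>v y)) \<bullet>c (X *\<^sub>v y)"
    using adjoint_mult_cscalar_prod_self[OF L Xy] by (simp only: M_def L'_def)
  also have "M *\<^sub>v (X *\<^sub>v y) = L' *\<^sub>v y"
    using assoc_mult_mat_vec[OF M X y] by (simp only: MX)
  also have "(L' *\<^sub>v y) \<bullet>c (X *\<^sub>v y) = y \<bullet>c (L *\<^sub>v (X *\<^sub>v y))"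
    unfolding L'_def by (rule mat_adjoint_cscalar_prod[OF L y Xy])
  finally have "(vec_l2norm (L *\<^sub>v (X *\<^sub>v y)))\<^sup>2 = cmod (y \<bullet>c (L *\<^sub>v (X *\<^sub>v y)))"
    by (metis norm_of_real abs_power2)
  also have "\<dots> \<le> vec_l2norm y * vec_l2norm (L *\<^sub>v (X *\<^sub>v y))"
    using L y by (intro cscalar_prod_Cauchy_Schwarz) simp
  finally have sq: "vec_l2norm (L *\<^sub>v (X *\<^sub>v y)) * vec_l2norm (L *\<^sub>v (X *\<^sub>v y))
      \<le> vec_l2norm y * vec_l2norm (L *\<^sub>v (X *\<^sub>v y))"
    by (simp only: power2_eq_square)
  show "vec_l2norm (L *\<^sub>v (pseudoinverse L *\<^sub>v y)) \<le> vec_l2norm y"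
  proof (rule ccontr)
    assume "\<not> ?thesis"
    then have "vec_l2norm y < vec_l2norm (L *\<^sub>v (X *\<^sub>v y))"
      by (simp add: X_def)
    moreover from this have "0 < vec_l2norm (L *\<^sub>v (X *\<^sub>v y))"
      using vec_l2norm_nonneg order.strict_trans1 by blast
    ultimately show False
      using sq by (simp only: mult_le_cancel_right_pos)
  qed
qed

section \<open>Linear combinations and the Gram matrix\<close>

lemma lin_comb_carrier [simp]: "lin_comb m n p c B \<in> carrier_mat m n"
  by (simp add: lin_comb_def)

lemma lin_comb_dim [simp]: "dim_row (lin_comb m n p c B) = m" "dim_col (lin_comb m n p c B) = n"
  by (simp_all add: lin_comb_def)

lemma spectral_norm_lin_comb_le:
  assumes "\<And>j. j < p \<Longrightarrow> B j \<in> carrier_mat m n"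
  shows "spectral_norm (lin_comb m n p c B) \<le> (\<Sum>j<p. cmod (c j) * spectral_norm (B j))"
  using assms
proof (induction p)
  case 0
  have "frobenius_norm (lin_comb m n 0 c B) = 0"
    by (simp add: frobenius_norm_def lin_comb_def)
  then show ?case
    using spectral_norm_le_frobenius[of "lin_comb m n 0 c B"] by simp
next
  case (Suc p)
  have B: "B p \<in> carrier_mat m n"
    by (rule Suc.prems) simp
  have "lin_comb m n (Suc p) c B = lin_comb m n p c B + c p \<cdot>\<^sub>m B p"
    using B by (intro eq_matI) (simp_all add: lin_comb_def)
  then have "spectral_norm (lin_comb m n (Suc p) c B)
      \<le> spectral_norm (lin_comb m n p c B) + spectral_norm (c p \<cdot>\<^sub>m B p)"
    using spectral_norm_triangle[of "lin_comb m n p c B" m n "c p \<cdot>\<^sub>m B p"] B by simp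
  then show ?case
    using Suc.IH Suc.prems spectral_norm_smult_le[of "c p" "B p"] by fastforce
qed

section \<open>The query matrix and its action on coefficient vectors\<close>

lemma query_matrix_carrier [simp]: "query_matrix m n p B u \<in> carrier_mat m p"
  by (rule carrier_matI) (simp_all add: query_matrix_def)

lemma query_matrix_dim [simp]:
  "dim_row (query_matrix m n p B u) = m" "dim_col (query_matrix m n p B u) = p"
  by (simp_all add: query_matrix_def)

lemma query_matrix_index:
  assumes "j < p" "i < m" and B: "B j \<in> carrier_mat m n"
  shows "query_matrix m n p B u $$ (i, j) = (\<Sum>k<n. B j $$ (i, k) * complex_of_real (u k))"
proof -
  have "query_matrix m n p B u $$ (i, j) = (B j *\<^sub>v cvec_of n u) $ i"
    using assms by (simp add: query_matrix_def mat_of_cols_index)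
  also have "\<dots> = (\<Sum>k<n. B j $$ (i, k) * complex_of_real (u k))"
    using B \<open>i < m\<close> by (subst mult_mat_vec_index_sum) (auto simp: cvec_of_def)
  finally show ?thesis .
qed

text \<open>This passes from matrices to coefficients: with it, A u becomes L d + E u.\<close>

lemma query_matrix_mult_vec:
  assumes B: "\<And>j. j < p \<Longrightarrow> B j \<in> carrier_mat m n" and a: "a \<in> carrier_vec p"
  shows "query_matrix m n p B u *\<^sub>v a = lin_comb m n p (\<lambda>j. a $ j) B *\<^sub>v cvec_of n u"
proof (rule eq_vecI)
  fix i assume "i < dim_vec (lin_comb m n p (\<lambda>j. a $ j) B *\<^sub>v cvec_of n u)"
  then have i: "i < m"
    by simp
  have Q: "query_matrix m n p B u $$ (i, j) = (\<Sum>k<n. B j $$ (i, k) * complex_of_real (u k))" if "j < p" for j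
    by (rule query_matrix_index[where B = B, OF that i B[OF that]])
  have "(query_matrix m n p B u *\<^sub>v a) $ i = (\<Sum>j<p. query_matrix m n p B u $$ (i, j) * a $ j)"
    using i a by (subst mult_mat_vec_index_sum) simp_all
  also have "\<dots> = (\<Sum>j<p. \<Sum>k<n. a $ j * B j $$ (i, k) * cvec_of n u $ k)"
    by (simp add: Q sum_distrib_left mult_ac cvec_of_def)
  also have "\<dots> = (\<Sum>k<n. \<Sum>j<p. a $ j * B j $$ (i, k) * cvec_of n u $ k)"
    by (rule sum.swap)
  also have "\<dots> = (\<Sum>k<n. lin_comb m n p (\<lambda>j. a $ j) B $$ (i, k) * cvec_of n u $ k)"
    using i by (simp add: lin_comb_def sum_distrib_right)
  also have "\<dots> = (lin_comb m n p (\<lambda>j. a $ j) B *\<^sub>v cvec_of n u) $ i"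
    using i by (subst mult_mat_vec_index_sum) (auto simp: cvec_of_def)
  finally show "(query_matrix m n p B u *\<^sub>v a) $ i = (lin_comb m n p (\<lambda>j. a $ j) B *\<^sub>v cvec_of n u) $ i" .
qed (simp add: query_matrix_def)

section \<open>Frobenius inner products and vectorisation of the family\<close>

lemma adjoint_mult_index:
  fixes A B :: "complex Matrix.mat"
  assumes "A \<in> carrier_mat m p" "B \<in> carrier_mat m q" "j < p" "k < q"
  shows "(mat_adjoint A * B) $$ (j, k) = (\<Sum>i<m. cnj (A $$ (i, j)) * B $$ (i, k))"
  using assms by (simp add: scalar_prod_def lessThan_atLeast0 mat_adjoint_index)

lemma frobenius_inner_sum:
  assumes A: "A \<in> carrier_mat m n" and B: "B \<in> carrier_mat m n"
  shows "frobenius_inner A B = (\<Sum>i<m. \<Sum>k<n. cnj (A $$ (i, k)) * B $$ (i, k))"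
proof -
  have "frobenius_inner A B = (\<Sum>k<n. \<Sum>i<m. cnj (A $$ (i, k)) * B $$ (i, k))"
    using A B by (simp add: frobenius_inner_def mat_trace_def adjoint_mult_index[OF A B] del: index_mult_mat(1))
  then show ?thesis
    by (simp only: sum.swap[of _ "{..<n}"])
qed

lemma frobenius_inner_self:
  assumes A: "A \<in> carrier_mat m n"
  shows "frobenius_inner A A = complex_of_real ((frobenius_norm A)\<^sup>2)"
proof -
  have "(frobenius_norm A)\<^sup>2 = (\<Sum>i<m. \<Sum>k<n. (cmod (A $$ (i, k)))\<^sup>2)"
    using A by (simp add: frobenius_norm_def sum_nonneg)
  then show ?thesis
    unfolding frobenius_inner_sum[OF A A]
    by (simp only: complex_norm_square of_real_sum mult.commute[of "cnj _"])
qed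

text \<open>Row-major enumeration: r = i n + k encodes the pair (i, k), as in the vectorised
  matrices of \<open>family_matrix\<close>.\<close>

lemma sum_div_mod: "(\<Sum>r<m * n. f (r div n) (r mod n)) = (\<Sum>i<m. \<Sum>k<n. f i (k :: nat))"
proof (cases "n = 0")
  case False
  have "(\<Sum>i<m. \<Sum>k<n. f i k) = (\<Sum>(i, k)\<in>{..<m} \<times> {..<n}. f i k)"
    by (rule sum.cartesian_product)
  also have "\<dots> = (\<Sum>r<m * n. f (r div n) (r mod n))"
  proof (rule sum.reindex_bij_witness[where i = "\<lambda>r. (r div n, r mod n)" and j = "\<lambda>(i, k). i * n + k"])
    fix z assume "z \<in> {..<m} \<times> {..<n}"
    then obtain i k where z: "z = (i, k)" "i < m" "k < n"
      by auto
    have "i * n + k < Suc i * n"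
      using z by simp
    also have "\<dots> \<le> m * n"
      using z by (intro mult_right_mono) simp_all
    finally show "(case z of (i, k) \<Rightarrow> i * n + k) \<in> {..<m * n}"
      using z by simp
  qed (use False in \<open>auto simp: less_mult_imp_div_less\<close>)
  finally show ?thesis ..
qed simp

(* The columns are the vectorised matrices B j, so that the Gram matrix is an adjoint product. *)
definition family_matrix ::
    "nat \<Rightarrow> nat \<Rightarrow> nat \<Rightarrow> (nat \<Rightarrow> complex Matrix.mat) \<Rightarrow> complex Matrix.mat" where
  "family_matrix m n p B = Matrix.mat (m * n) p (\<lambda>(r, j). B j $$ (r div n, r mod n))"

lemma family_matrix_carrier [simp]: "family_matrix m n p B \<in> carrier_mat (m * n) p"
  by (simp add: family_matrix_def)

lemma gram_matrix_eq_adjoint_mult: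
  assumes B: "\<And>j. j < p \<Longrightarrow> B j \<in> carrier_mat m n"
  shows "gram_matrix p B = mat_adjoint (family_matrix m n p B) * family_matrix m n p B"
proof (rule eq_matI)
  fix j k
  assume "j < dim_row (mat_adjoint (family_matrix m n p B) * family_matrix m n p B)"
    and "k < dim_col (mat_adjoint (family_matrix m n p B) * family_matrix m n p B)"
  then have jk: "j < p" "k < p"
    by (simp_all add: family_matrix_def)
  have "(mat_adjoint (family_matrix m n p B) * family_matrix m n p B) $$ (j, k)
      = (\<Sum>r<m * n. cnj (family_matrix m n p B $$ (r, j)) * family_matrix m n p B $$ (r, k))"
    by (rule adjoint_mult_index[OF family_matrix_carrier family_matrix_carrier jk])
  also have "\<dots> = (\<Sum>r<m * n. cnj (B j $$ (r div n, r mod n)) * B k $$ (r div n, r mod n))"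
    using jk by (simp add: family_matrix_def)
  also have "\<dots> = frobenius_inner (B j) (B k)"
    unfolding frobenius_inner_sum[OF B[OF jk(1)] B[OF jk(2)]] by (rule sum_div_mod)
  finally show "gram_matrix p B $$ (j, k)
      = (mat_adjoint (family_matrix m n p B) * family_matrix m n p B) $$ (j, k)"
    using jk by (simp add: gram_matrix_def)
qed (simp_all add: gram_matrix_def family_matrix_def)

section \<open>The deterministic error bound\<close>

lemma weak_condition_number_nonneg: "0 \<le> weak_condition_number A"
  by (simp add: weak_condition_number_def)

lemma weak_condition_number_ge_1: "frobenius_norm A \<noteq> 0 \<Longrightarrow> 1 \<le> weak_condition_number A"
  using frobenius_norm_le_spectral[of A] frobenius_norm_nonneg[of A]
  by (simp add: weak_condition_number_def mult.commute del: frobenius_norm_nonneg)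

text \<open>In this multiplied form the defining equation survives for a zero matrix, where the
  spectral norm vanishes along with the Frobenius norm.\<close>

lemma spectral_norm_eq_weak_condition_number:
  "spectral_norm A * sqrt (dim_col A) = weak_condition_number A * frobenius_norm A"
  using spectral_norm_le_frobenius[of A] spectral_norm_nonneg[of A]
  by (cases "frobenius_norm A = 0") (auto simp: weak_condition_number_def)

lemma vec_l2norm_cvec_of: "vec_l2norm (cvec_of n u) = sqrt (\<Sum>i<n. (u i)\<^sup>2)"
  by (simp add: vec_l2norm_def cvec_of_def)

text \<open>The constant 3 is 2 + 1: the 2 is the square root of the 4 in the bound on the sum of
  squares, and the 1 accounts for E itself in the residual.\<close>

lemma recovery_error_bound:
  assumes n: "n \<ge> 1" and p: "p \<ge> 1"
    and B: "\<And>j. j < p \<Longrightarrow> B j \<in> carrier_mat m n"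
    and \<kappa>: "ereal \<kappa> = family_condition_number p B"
    and E: "E \<in> carrier_mat m n" and E_le: "spectral_norm E \<le> \<epsilon>"
    and A: "A = lin_comb m n p d B + E"
    and t: "0 < t" "t < 1"
    and dev: "spectral_norm (query_gram m n p B u - gram_matrix p B)
      \<le> t * spectral_norm (gram_matrix p B) / \<kappa>"
    and u: "(\<Sum>i<n. (u i)\<^sup>2) \<le> 4 * real n"
  shows "spectral_norm (A - lin_comb m n p (\<lambda>j. recovered_coeffs m n p B A u $ j) B)
      \<le> 3 * \<epsilon> * family_weak_condition_number p B * sqrt (\<kappa> * real p / (1 - t))"
proof -
  define G where "G = family_matrix m n p B"
  define N where "N = gram_matrix p B"
  define L where "L = query_matrix m n p B u"
  define \<Lambda> where "\<Lambda> = family_weak_condition_number p B"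
  define v where "v = cvec_of n u"
  have N: "N \<in> carrier_mat p p"
    by (simp add: N_def gram_matrix_def)
  have G: "G \<in> carrier_mat (m * n) p" and L: "L \<in> carrier_mat m p"
    by (simp_all add: G_def L_def)
  have v: "v \<in> carrier_vec n"
    by (simp add: v_def cvec_of_def)
  have NG: "N = mat_adjoint G * G"
    unfolding N_def G_def by (rule gram_matrix_eq_adjoint_mult[OF B])
  \<comment> \<open>A singular Gram matrix would have condition number \<infinity>, whereas \<kappa>
    is real.\<close>
  obtain H where inv: "mat_inverse N = Some H" and \<kappa>_eq: "\<kappa> = spectral_norm N * spectral_norm H"
    using \<kappa> by (cases "mat_inverse N")
      (auto simp: family_condition_number_def condition_number_def N_def[symmetric])
  have NH: "N * H = 1\<^sub>m p" and H: "H \<in> carrier_mat p p"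
    using mat_inverse(2)[OF N inv] by auto
  define h where "h = spectral_norm H"
  define \<nu> where "\<nu> = spectral_norm N"
  have \<kappa>_ge: "1 \<le> \<kappa>"
    unfolding \<kappa>_eq by (rule spectral_norm_mult_inverse_ge_1[OF N H NH p])
  have h0: "h \<ge> 0" and \<nu>0: "\<nu> \<ge> 0" and \<kappa>h: "\<kappa> = \<nu> * h"
    by (simp_all add: h_def \<nu>_def \<kappa>_eq)
  have h: "h > 0" and \<nu>: "\<nu> > 0"
    using \<kappa>_ge h0 \<nu>0 by (auto simp: \<kappa>h less_le)
  \<comment> \<open>Because \<kappa> = \<nu> h, the deviation hypothesis says exactly that |M - N| h
    <= t.\<close>
  have "spectral_norm (mat_adjoint L * L - mat_adjoint G * G) * h \<le> (t * \<nu> / \<kappa>) * h"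
    using dev h0 by (intro mult_right_mono) (simp_all add: query_gram_def L_def N_def[symmetric] NG[symmetric] \<nu>_def)
  also have "\<dots> = t"
    using h \<nu> by (simp add: \<kappa>h)
  finally have lower: "(1 - t) * (vec_l2norm x)\<^sup>2 \<le> h * (vec_l2norm (L *\<^sub>v x))\<^sup>2" if "x \<in> carrier_vec p" for x
    unfolding h_def using NH that by (intro adjoint_mult_lower_bound_perturbed[OF G H _ L]) (simp_all add: NG)
  have inj: "x = 0\<^sub>v p" if "x \<in> carrier_vec p" "vec_l2norm (L *\<^sub>v x) = 0" for x
  proof -
    have "(1 - t) * (vec_l2norm x)\<^sup>2 \<le> 0"
      using lower[OF that(1)] that(2) by simp
    then have "vec_l2norm x = 0"
      using t by (simp add: mult_le_0_iff)
    then show ?thesis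
      using that(1) by (simp add: vec_l2norm_eq_0_iff)
  qed
  define X where "X = pseudoinverse L"
  have X: "X \<in> carrier_mat p m" "X * L = 1\<^sub>m p"
    unfolding X_def using pseudoinverse_least_squares(1,2)[OF L] inj by blast+
  have X_le: "vec_l2norm (L *\<^sub>v (X *\<^sub>v y)) \<le> vec_l2norm y" if "y \<in> carrier_vec m" for y
    unfolding X_def using pseudoinverse_least_squares(3)[OF L] inj that by blast
  define a where "a = X *\<^sub>v (E *\<^sub>v v)"
  have Ev: "E *\<^sub>v v \<in> carrier_vec m"
    using E v by simp
  have a: "a \<in> carrier_vec p"
    using X(1) Ev by (simp add: a_def)
  have c: "recovered_coeffs m n p B A u = Matrix.vec p d + a"
  proof -
    have "lin_comb m n p (\<lambda>j. Matrix.vec p d $ j) B = lin_comb m n p d B"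
      by (rule eq_matI) (simp_all add: lin_comb_def)
    then have "lin_comb m n p d B *\<^sub>v v = L *\<^sub>v Matrix.vec p d"
      using query_matrix_mult_vec[of p B m n "Matrix.vec p d" u] B by (simp add: L_def v_def)
    then have "A *\<^sub>v v = L *\<^sub>v Matrix.vec p d + E *\<^sub>v v"
      unfolding A using add_mult_distrib_mat_vec[OF lin_comb_carrier E v] by simp
    then have "recovered_coeffs m n p B A u = X *\<^sub>v (L *\<^sub>v Matrix.vec p d + E *\<^sub>v v)"
      by (simp add: recovered_coeffs_def X_def L_def v_def)
    also have "\<dots> = X *\<^sub>v (L *\<^sub>v Matrix.vec p d) + a"
      unfolding a_def using L by (intro mult_add_distrib_mat_vec[OF X(1) _ Ev]) (rule mult_mat_vec_carrier, simp_all)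
    also have "X *\<^sub>v (L *\<^sub>v Matrix.vec p d) = Matrix.vec p d"
      using assoc_mult_mat_vec[OF X(1) L, of "Matrix.vec p d"] by (simp add: X(2))
    finally show ?thesis .
  qed
  have resid: "A - lin_comb m n p (\<lambda>j. recovered_coeffs m n p B A u $ j) B
      = E + lin_comb m n p (\<lambda>j. - a $ j) B"
    unfolding c using E a
    by (intro eq_matI) (auto simp: A lin_comb_def algebra_simps sum.distrib sum_negf)
  have \<epsilon>: "\<epsilon> \<ge> 0"
    using E_le spectral_norm_nonneg order_trans by blast
  have v_le: "vec_l2norm v \<le> 2 * sqrt n"
  proof -
    have "vec_l2norm v \<le> sqrt (4 * real n)"
      unfolding v_def vec_l2norm_cvec_of by (rule real_sqrt_le_mono[OF u])
    then show ?thesis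
      by (simp add: real_sqrt_mult)
  qed
  have "vec_l2norm (L *\<^sub>v a) \<le> vec_l2norm (E *\<^sub>v v)"
    unfolding a_def by (rule X_le[OF Ev])
  also have "\<dots> \<le> spectral_norm E * vec_l2norm v"
    using E v by (intro vec_l2norm_mult_le_spectral) simp
  also have "\<dots> \<le> \<epsilon> * (2 * sqrt n)"
    by (intro mult_mono E_le v_le \<epsilon>) simp
  finally have La: "vec_l2norm (L *\<^sub>v a) \<le> \<epsilon> * (2 * sqrt n)" .
  have "(vec_l2norm a)\<^sup>2 \<le> h / (1 - t) * (vec_l2norm (L *\<^sub>v a))\<^sup>2"
    using lower[OF a] t by (simp add: field_simps)
  also have "\<dots> \<le> h / (1 - t) * (\<epsilon> * (2 * sqrt n))\<^sup>2"
    using La h t by (intro mult_left_mono power_mono) simp_all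
  finally have "vec_l2norm a \<le> sqrt (h / (1 - t) * (\<epsilon> * (2 * sqrt n))\<^sup>2)"
    by (rule real_le_rsqrt)
  also have "\<dots> = sqrt (h / (1 - t)) * (\<epsilon> * (2 * sqrt n))"
    unfolding real_sqrt_mult[of "h / (1 - t)"] using \<epsilon> by simp
  finally have a_le: "vec_l2norm a \<le> sqrt (h / (1 - t)) * (\<epsilon> * (2 * sqrt n))" .
  have wcn_le: "weak_condition_number (B j) \<le> \<Lambda>" if "j < p" for j
    unfolding \<Lambda>_def family_weak_condition_number_def using that by (intro Max_ge) auto
  have \<Lambda>0: "0 \<le> \<Lambda>"
    using wcn_le[of 0] weak_condition_number_nonneg[of "B 0"] p by simp
  have Njj: "N $$ (j, j) = complex_of_real ((frobenius_norm (B j))\<^sup>2)" if "j < p" for j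
    using frobenius_inner_self[OF B[OF that]] that by (simp add: N_def gram_matrix_def)
  have frob_le: "frobenius_norm (B j) \<le> sqrt \<nu>" if "j < p" for j
  proof -
    have "cmod (N $$ (j, j)) \<le> \<nu>"
      unfolding \<nu>_def using N that by (intro cmod_entry_le_spectral_norm) auto
    then show ?thesis
      by (intro real_le_rsqrt) (simp add: Njj[OF that] norm_power)
  qed
  have B_le: "spectral_norm (B j) \<le> \<Lambda> * sqrt \<nu> / sqrt n" if "j < p" for j
  proof -
    have "spectral_norm (B j) * sqrt n = weak_condition_number (B j) * frobenius_norm (B j)"
      using spectral_norm_eq_weak_condition_number[of "B j"] B[OF that] by simp
    also have "\<dots> \<le> \<Lambda> * sqrt \<nu>"
      by (intro mult_mono wcn_le frob_le that \<Lambda>0) simp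
    finally show ?thesis
      using n by (simp add: pos_le_divide_eq)
  qed
  \<comment> \<open>Pairing with the all-ones vector, of length sqrt p, produces the factor sqrt p
    of the final bound.\<close>
  have sum_le: "(\<Sum>j<p. cmod (a $ j)) \<le> vec_l2norm a * sqrt p"
  proof -
    have "(\<Sum>j<p. \<bar>cmod (a $ j)\<bar> * \<bar>1\<bar>) \<le> L2_set (\<lambda>j. cmod (a $ j)) {..<p} * L2_set (\<lambda>_. 1) {..<p}"
      by (rule L2_set_mult_ineq)
    then show ?thesis
      using a by (simp add: vec_l2norm_L2_set) (simp add: L2_set_def)
  qed
  have "spectral_norm (lin_comb m n p (\<lambda>j. - a $ j) B) \<le> (\<Sum>j<p. cmod (- a $ j) * spectral_norm (B j))"
    by (rule spectral_norm_lin_comb_le[OF B])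
  also have "\<dots> \<le> (\<Sum>j<p. cmod (a $ j) * (\<Lambda> * sqrt \<nu> / sqrt n))"
    by (intro sum_mono) (simp add: B_le mult_left_mono del: times_divide_eq_right)
  also have "\<dots> = (\<Sum>j<p. cmod (a $ j)) * (\<Lambda> * sqrt \<nu> / sqrt n)"
    by (simp only: sum_distrib_right)
  also have "\<dots> \<le> (sqrt (h / (1 - t)) * (\<epsilon> * (2 * sqrt n)) * sqrt p) * (\<Lambda> * sqrt \<nu> / sqrt n)"
    using \<Lambda>0 \<nu>0 by (intro mult_right_mono order_trans[OF sum_le] a_le) simp_all
  \<comment> \<open>The sqrt n from |u| cancels against the one in \<open>B_le\<close>; next, h and
    \<nu> recombine to \<kappa>.\<close>
  also have "\<dots> = 2 * \<epsilon> * \<Lambda> * (sqrt (h / (1 - t)) * sqrt p * sqrt \<nu>)"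
    using n by (simp add: field_simps)
  also have "sqrt (h / (1 - t)) * sqrt p * sqrt \<nu> = sqrt (\<kappa> * real p / (1 - t))"
    unfolding real_sqrt_mult[symmetric] by (simp add: \<kappa>h mult_ac)
  finally have comb_le: "spectral_norm (lin_comb m n p (\<lambda>j. - a $ j) B)
      \<le> 2 * \<epsilon> * \<Lambda> * sqrt (\<kappa> * real p / (1 - t))" .
  \<comment> \<open>Division by zero would give a zero matrix the weak condition number 0, so B_0
    must be shown nonzero. Its squared Frobenius norm is the corner entry of N, which equals |G x|^2
    for the first unit vector x, and G is injective by
    \<open>adjoint_mult_lower_bound\<close>.\<close>
  have "1 \<le> \<Lambda>"
  proof -
    define x :: "complex Matrix.vec" where "x = unit_vec p 0"
    have x: "x \<in> carrier_vec p"
      by (simp add: x_def)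
    have "vec_l2norm x = 1"
      using p by (simp add: x_def vec_l2norm_unit_vec)
    then have "vec_l2norm (G *\<^sub>v x) \<noteq> 0"
      using adjoint_mult_lower_bound[OF G H _ x] NH by (auto simp: NG)
    then have "((N *\<^sub>v x) \<bullet>c x) \<noteq> 0"
      using adjoint_mult_cscalar_prod_self[OF G x] by (simp add: NG)
    moreover have "(N *\<^sub>v x) \<bullet>c x = N $$ (0, 0)"
    proof -
      have "(N *\<^sub>v x) \<bullet>c x = (\<Sum>i<p. if i = 0 then (N *\<^sub>v x) $ 0 else 0)"
        unfolding cscalar_prod_sum by (intro sum.cong) (auto simp: x_def)
      then show ?thesis
        using p N by (simp add: x_def)
    qed
    ultimately have "frobenius_norm (B 0) \<noteq> 0"
      using Njj[of 0] p by auto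
    then show ?thesis
      using weak_condition_number_ge_1[of "B 0"] wcn_le[of 0] p by simp
  qed
  moreover have "1 \<le> sqrt (\<kappa> * real p / (1 - t))"
  proof -
    have "1 * 1 \<le> \<kappa> * real p"
      using \<kappa>_ge p by (intro mult_mono) simp_all
    then show ?thesis
      using t by (simp add: le_divide_eq)
  qed
  ultimately have "1 * 1 \<le> \<Lambda> * sqrt (\<kappa> * real p / (1 - t))"
    by (intro mult_mono) simp_all
  then have "\<epsilon> \<le> \<epsilon> * (\<Lambda> * sqrt (\<kappa> * real p / (1 - t)))"
    using \<epsilon> mult_left_mono[of 1 "\<Lambda> * sqrt (\<kappa> * real p / (1 - t))" \<epsilon>] by simp
  moreover have "spectral_norm (E + lin_comb m n p (\<lambda>j. - a $ j) B)
      \<le> spectral_norm E + spectral_norm (lin_comb m n p (\<lambda>j. - a $ j) B)"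
    by (rule spectral_norm_triangle[OF E lin_comb_carrier])
  ultimately show ?thesis
    unfolding resid \<Lambda>_def[symmetric] using E_le comb_le by (simp add: mult.assoc)
qed

section \<open>Second moments of the random vector\<close>

text \<open>Independent centred variables are orthogonal. With g x = x this yields the expectation
  of M, and with g x = x^2 - 1 the variance of the sum of squares.\<close>

lemma has_bochner_integral_PiM_pair:
  fixes g :: "real \<Rightarrow> real"
  assumes \<mu>: "prob_space \<mu>" and I: "finite I" "a \<in> I" "b \<in> I"
    and g: "has_bochner_integral \<mu> g 0" and g2: "has_bochner_integral \<mu> (\<lambda>x. (g x)\<^sup>2) s"
  shows "has_bochner_integral (\<Pi>\<^sub>M i\<in>I. \<mu>) (\<lambda>u. g (u a) * g (u b)) (if a = b then s else 0)"
proof -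
  interpret prob_space \<mu> by (rule \<mu>)
  interpret product_sigma_finite "\<lambda>_. \<mu>" ..
  \<comment> \<open>Two separate conditional factors let the product over I split into g (u a) and g
    (u b), and they merge into g^2 by themselves when a = b.\<close>
  define f where "f i x = (if i = a then g x else 1) * (if i = b then g x else 1)" for i x
  have hbi: "has_bochner_integral \<mu> (f i) (if i = a then if i = b then s else 0 else if i = b then 0 else 1)" for i
    using g g2 
    unfolding f_def by (auto simp: power2_eq_square has_bochner_integral_iff prob_space)
  have int: "integrable \<mu> (f i)" for i
    using hbi by (rule integrable.intros)
  have f: "(\<Prod>i\<in>I. f i (u i)) = g (u a) * g (u b)" for u
    using I by (simp add: f_def prod.distrib)
  have "(\<Prod>i\<in>I. integral\<^sup>L \<mu> (f i)) = (if a = b then s else 0)"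
  proof (cases "a = b")
    case True
    have "(\<Prod>i\<in>I. integral\<^sup>L \<mu> (f i)) = (\<Prod>i\<in>I. if i = a then s else 1)"
      unfolding has_bochner_integral_integral_eq[OF hbi] using True by (intro prod.cong) auto
    then show ?thesis
      using I True by simp
  next
    case False
    then show ?thesis
      using I by (auto simp: has_bochner_integral_integral_eq[OF hbi] intro!: prod_zero)
  qed
  then show ?thesis
    using product_integrable_prod[of I f, OF I(1) int] product_integral_prod[of I f, OF I(1) int]
    by (simp add: f has_bochner_integral_iff)
qed

text \<open>Only these moments of the entries matter, so Gaussian and Rademacher vectors are treated
  together. The fourth moment is 3 for the former and 1 for the latter, whence the bound on
  q.\<close>

locale standardized = prob_space \<mu> for \<mu> :: "real measure" +
  fixes q :: real
  assumes mean: "has_bochner_integral \<mu> (\<lambda>x. x) 0"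
    and variance: "has_bochner_integral \<mu> (\<lambda>x. x\<^sup>2) 1"
    and fourth_moment: "has_bochner_integral \<mu> (\<lambda>x. x ^ 4) q" "q \<le> 3"
begin

lemma prob_space_PiM_power: "prob_space (\<Pi>\<^sub>M i\<in>I. \<mu>)"
  by (rule prob_space_PiM) (rule prob_space_axioms)

text \<open>An entry of M is a double sum over products u_a u_b. Those with distinct indices average
  to 0 and the squares to 1, which leaves the entrywise sum of the Frobenius inner product.\<close>

lemma expected_query_gram:
  assumes B: "\<And>j. j < p \<Longrightarrow> B j \<in> carrier_mat m n"
  shows "expected_mat (\<Pi>\<^sub>M i\<in>{..<n}. \<mu>) p p (query_gram m n p B) = gram_matrix p B"
proof (rule eq_matI)
  fix j k assume "j < dim_row (gram_matrix p B)" "k < dim_col (gram_matrix p B)"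
  then have jk: "j < p" "k < p"
    by (simp_all add: gram_matrix_def)
  have gram: "query_gram m n p B u $$ (j, k)
      = (\<Sum>i<m. \<Sum>a<n. \<Sum>b<n. (cnj (B j $$ (i, a)) * B k $$ (i, b)) * complex_of_real (u a * u b))" for u
    unfolding query_gram_def adjoint_mult_index[OF query_matrix_carrier query_matrix_carrier jk]
    by (rule sum.cong, rule refl, simp only: query_matrix_index B jk lessThan_iff cnj_sum sum_product)
      (simp add: mult_ac)
  have "has_bochner_integral (\<Pi>\<^sub>M i\<in>{..<n}. \<mu>) (\<lambda>u. query_gram m n p B u $$ (j, k))
      (\<Sum>i<m. \<Sum>a<n. \<Sum>b<n. (cnj (B j $$ (i, a)) * B k $$ (i, b)) * complex_of_real (if a = b then 1 else 0))"
    unfolding gram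
    by (intro has_bochner_integral_sum has_bochner_integral_mult_right has_bochner_integral_of_real
        has_bochner_integral_PiM_pair[OF prob_space_axioms _ _ _ mean variance]) auto
  also have "(\<Sum>i<m. \<Sum>a<n. \<Sum>b<n. (cnj (B j $$ (i, a)) * B k $$ (i, b)) * complex_of_real (if a = b then 1 else 0))
      = frobenius_inner (B j) (B k)"
    unfolding frobenius_inner_sum[OF B[OF jk(1)] B[OF jk(2)]]
    by (simp add: if_distrib[of complex_of_real] if_distrib[of "times _"] cong: if_cong)
  finally show "expected_mat (\<Pi>\<^sub>M i\<in>{..<n}. \<mu>) p p (query_gram m n p B) $$ (j, k) = gram_matrix p B $$ (j, k)"
    using jk by (simp add: expected_mat_def gram_matrix_def has_bochner_integral_integral_eq)
qed (simp_all add: expected_mat_def gram_matrix_def)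

lemma borel_measurable_PiM_sum_squares:
  "(\<lambda>u. \<Sum>i<n. (u i)\<^sup>2) \<in> borel_measurable (\<Pi>\<^sub>M i\<in>{..<n}. \<mu>)"
proof -
  have "(\<lambda>x. x) \<in> borel_measurable \<mu>"
    using mean by (rule borel_measurable_has_bochner_integral)
  then have "(\<lambda>u. u i) \<in> borel_measurable (\<Pi>\<^sub>M i\<in>{..<n}. \<mu>)" if "i < n" for i
    using measurable_compose[OF measurable_component_singleton[of i "{..<n}" "\<lambda>_. \<mu>"]] that by simp
  then show ?thesis
    by (intro borel_measurable_sum borel_measurable_power) simp
qed

(* Chebyshev: the sum of squares has mean n and variance (q - 1) n \<le> 2 n. *)
lemma prob_sum_squares_gt_le:
  assumes n: "n \<ge> 1"
  shows "measure (\<Pi>\<^sub>M i\<in>{..<n}. \<mu>) {u \<in> space (\<Pi>\<^sub>M i\<in>{..<n}. \<mu>). (\<Sum>i<n. (u i)\<^sup>2) > 4 * real n}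
      \<le> 2 / (9 * real n)"
proof -
  define P where "P = (\<Pi>\<^sub>M i\<in>{..<n}. \<mu>)"
  interpret P: prob_space P
    unfolding P_def by (rule prob_space_PiM_power)
  \<comment> \<open>The summands are centred one by one, so that
    \<open>has_bochner_integral_PiM_pair\<close> removes all mixed terms of the square.\<close>
  define S where "S u = (\<Sum>i<n. (u i)\<^sup>2 - 1)" for u :: "nat \<Rightarrow> real"
  have S: "S u = (\<Sum>i<n. (u i)\<^sup>2) - real n" for u
    by (simp add: S_def sum_subtractf)
  have one: "has_bochner_integral \<mu> (\<lambda>_. c) c" for c :: real
    by (simp add: has_bochner_integral_iff prob_space)
  have "has_bochner_integral \<mu> (\<lambda>x. x\<^sup>2 - 1) (1 - 1)"
    by (intro has_bochner_integral_diff variance one)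
  moreover have "has_bochner_integral \<mu> (\<lambda>x. x ^ 4 - 2 * x\<^sup>2 + 1) (q - 2 * 1 + 1)"
    by (intro has_bochner_integral_add has_bochner_integral_diff has_bochner_integral_mult_right
        fourth_moment variance one)
  then have "has_bochner_integral \<mu> (\<lambda>x. (x\<^sup>2 - 1)\<^sup>2) (q - 1)"
    by (simp add: power2_diff algebra_simps)
  ultimately have "has_bochner_integral P (\<lambda>u. \<Sum>a<n. \<Sum>b<n. ((u a)\<^sup>2 - 1) * ((u b)\<^sup>2 - 1))
      (\<Sum>a<n. \<Sum>b<n. if a = b then q - 1 else 0)"
    unfolding P_def
    by (intro has_bochner_integral_sum has_bochner_integral_PiM_pair[OF prob_space_axioms]) auto
  then have int: "has_bochner_integral P (\<lambda>u. (S u)\<^sup>2) (real n * (q - 1))"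
    by (simp add: S_def power2_eq_square sum_product)
  \<comment> \<open>The threshold 4 n lies 3 n above the mean n, hence 9 n^2 after squaring.\<close>
  have meas: "{u \<in> space P. (S u)\<^sup>2 \<ge> 9 * (real n)\<^sup>2} \<in> sets P"
    using borel_measurable_has_bochner_integral[OF int] by measurable
  have "measure P {u \<in> space P. (\<Sum>i<n. (u i)\<^sup>2) > 4 * real n}
      \<le> measure P {u \<in> space P. (S u)\<^sup>2 \<ge> 9 * (real n)\<^sup>2}"
  proof (rule P.finite_measure_mono[OF _ meas])
    show "{u \<in> space P. (\<Sum>i<n. (u i)\<^sup>2) > 4 * real n} \<subseteq> {u \<in> space P. (S u)\<^sup>2 \<ge> 9 * (real n)\<^sup>2}"
    proof safe
      fix u assume "4 * real n < (\<Sum>i<n. (u i)\<^sup>2)"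
      then have "3 * real n \<le> S u"
        by (simp add: S)
      then have "(3 * real n)\<^sup>2 \<le> (S u)\<^sup>2"
        by (intro power_mono) simp_all
      then show "9 * (real n)\<^sup>2 \<le> (S u)\<^sup>2"
        by (simp add: power_mult_distrib)
    qed
  qed
  also have "\<dots> \<le> (\<integral>u. (S u)\<^sup>2 \<partial>P) / (9 * (real n)\<^sup>2)"
    using n int by (intro integral_Markov_inequality_measure[where A = "space P"])
      (auto simp: has_bochner_integral_iff)
  also have "\<dots> = (q - 1) / (9 * real n)"
    unfolding has_bochner_integral_integral_eq[OF int] using n by (simp add: power2_eq_square)
  also have "\<dots> \<le> 2 / (9 * real n)"
    using fourth_moment(2) by (intro divide_right_mono) simp_all
  finally show ?thesis
    by (simp add: P_def)
qed

end

section \<open>Moments of the two laws, and passage to high probability\<close>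

lemma standardized_gaussian:
  "standardized (density lborel (\<lambda>x. ennreal (std_normal_density x))) 3"
proof -
  have hbi: "has_bochner_integral (density lborel (\<lambda>x. ennreal (std_normal_density x))) (\<lambda>x. x ^ k) c"
    if "has_bochner_integral lborel (\<lambda>x. std_normal_density x * x ^ k) c" for k c
    using that by (intro has_bochner_integral_density) simp_all
  interpret prob_space "density lborel (\<lambda>x. ennreal (std_normal_density x))"
    by (rule prob_space_normal_density) simp
  show ?thesis
  proof
    show "has_bochner_integral (density lborel (\<lambda>x. ennreal (std_normal_density x))) (\<lambda>x. x) 0"
      using hbi[OF std_normal_moment_odd[of 0]] by simp
    show "has_bochner_integral (density lborel (\<lambda>x. ennreal (std_normal_density x))) (\<lambda>x. x\<^sup>2) 1"
      using hbi[OF std_normal_moment_even[of 1]] by simp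
    show "has_bochner_integral (density lborel (\<lambda>x. ennreal (std_normal_density x))) (\<lambda>x. x ^ 4) 3"
      using hbi[OF std_normal_moment_even[of 2]] by (simp add: fact_numeral)
  qed simp
qed

lemma standardized_rademacher: "standardized (measure_pmf (pmf_of_set {-1, 1})) 1"
proof -
  have hbi: "has_bochner_integral (measure_pmf (pmf_of_set {-1, 1})) f ((f (-1) + f 1) / 2)"
    for f :: "real \<Rightarrow> real"
    by (simp add: has_bochner_integral_iff integrable_measure_pmf_finite integral_pmf_of_set)
  show ?thesis
    using hbi[of "\<lambda>x. x"] hbi[of "\<lambda>x. x\<^sup>2"] hbi[of "\<lambda>x. x ^ 4"]
    by (simp add: standardized_def standardized_axioms_def prob_space_measure_pmf)
qed

theorem proposition1p5:
  shows "\<exists>K::real. K > 0 \<and>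
    (\<forall>(m :: nat \<Rightarrow> nat) (p :: nat \<Rightarrow> nat) (B :: nat \<Rightarrow> nat \<Rightarrow> complex Matrix.mat)
      (P :: nat \<Rightarrow> (nat \<Rightarrow> real) measure)
      (N :: nat \<Rightarrow> complex Matrix.mat) (\<kappa> :: nat \<Rightarrow> real) (\<Lambda> :: nat \<Rightarrow> real)
      (A :: nat \<Rightarrow> complex Matrix.mat) (d :: nat \<Rightarrow> nat \<Rightarrow> complex)
      (E :: nat \<Rightarrow> complex Matrix.mat) (\<epsilon> :: nat \<Rightarrow> real) (t :: nat \<Rightarrow> real).
      (\<forall>n\<ge>1.
         m n \<ge> 1 \<and> p n \<ge> 1 \<and>
         (\<forall>j<p n. B n j \<in> carrier_mat (m n) n) \<and>
         (P n = gaussian_sequence n \<or> P n = rademacher_sequence n) \<and>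
         N n = expected_mat (P n) (p n) (p n) (query_gram (m n) n (p n) (B n)) \<and>
         family_condition_number (p n) (B n) < \<infinity> \<and>
         ereal (\<kappa> n) = family_condition_number (p n) (B n) \<and>
         \<Lambda> n = family_weak_condition_number (p n) (B n) \<and>
         E n \<in> carrier_mat (m n) n \<and> spectral_norm (E n) \<le> \<epsilon> n \<and>
         A n = lin_comb (m n) n (p n) (d n) (B n) + E n \<and>
         0 < t n \<and> t n < 1) \<longrightarrow>
      with_high_probability P (\<lambda>n u.
        spectral_norm (query_gram (m n) n (p n) (B n) u - N n)
          \<le> t n * spectral_norm (N n) / \<kappa> n) \<longrightarrow>
      with_high_probability P (\<lambda>n u.
        spectral_norm
          (A n - lin_comb (m n) n (p n) (\<lambda>j. recovered_coeffs (m n) n (p n) (B n) (A n) u $ j) (B n))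
          \<le> K * \<epsilon> n * \<Lambda> n * sqrt (\<kappa> n * real (p n) / (1 - t n))))"

proof (intro exI[of _ 3] conjI allI impI)
  fix m p :: "nat \<Rightarrow> nat" and B :: "nat \<Rightarrow> nat \<Rightarrow> complex Matrix.mat"
    and P :: "nat \<Rightarrow> (nat \<Rightarrow> real) measure"
    and N :: "nat \<Rightarrow> complex Matrix.mat" and \<kappa> \<Lambda> :: "nat \<Rightarrow> real"
    and A :: "nat \<Rightarrow> complex Matrix.mat" and d :: "nat \<Rightarrow> nat \<Rightarrow> complex"
    and E :: "nat \<Rightarrow> complex Matrix.mat" and \<epsilon> t :: "nat \<Rightarrow> real"
  assume *: "\<forall>n\<ge>1.
         m n \<ge> 1 \<and> p n \<ge> 1 \<and>
         (\<forall>j<p n. B n j \<in> carrier_mat (m n) n) \<and>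
         (P n = gaussian_sequence n \<or> P n = rademacher_sequence n) \<and>
         N n = expected_mat (P n) (p n) (p n) (query_gram (m n) n (p n) (B n)) \<and>
         family_condition_number (p n) (B n) < \<infinity> \<and>
         ereal (\<kappa> n) = family_condition_number (p n) (B n) \<and>
         \<Lambda> n = family_weak_condition_number (p n) (B n) \<and>
         E n \<in> carrier_mat (m n) n \<and> spectral_norm (E n) \<le> \<epsilon> n \<and>
         A n = lin_comb (m n) n (p n) (d n) (B n) + E n \<and>
         0 < t n \<and> t n < 1"
  assume "with_high_probability P (\<lambda>n u.
        spectral_norm (query_gram (m n) n (p n) (B n) u - N n)
          \<le> t n * spectral_norm (N n) / \<kappa> n)"
  then obtain F where F_sets: "\<And>n. F n \<in> sets (P n)"
    and F: "\<And>n u. u \<in> F n \<Longrightarrow> spectral_norm (query_gram (m n) n (p n) (B n) u - N n)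
          \<le> t n * spectral_norm (N n) / \<kappa> n"
    and F_lim: "(\<lambda>n. measure (P n) (F n)) \<longlonglongrightarrow> 1"
    unfolding with_high_probability_def by blast
  define G where "G n = {u \<in> space (P n). (\<Sum>i<n. (u i)\<^sup>2) \<le> 4 * real n}" for n
  (* The hypotheses constrain P 0 in no way. *)
  define F' where "F' n = (if n = 0 then {} else F n \<inter> G n)" for n
  have law: "\<exists>\<mu> q. standardized \<mu> q \<and> P n = (\<Pi>\<^sub>M i\<in>{..<n}. \<mu>)" if "n \<ge> 1" for n
    using * that standardized_gaussian standardized_rademacher
    unfolding gaussian_sequence_def rademacher_sequence_def by metis
  have G_sets: "G n \<in> sets (P n)" if n: "n \<ge> 1" for n
  proof -
    obtain \<mu> q where "standardized \<mu> q" and P: "P n = (\<Pi>\<^sub>M i\<in>{..<n}. \<mu>)"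
      using law[OF n] by blast
    then interpret standardized \<mu> q by simp
    show ?thesis
      unfolding G_def P by (rule borel_measurable_le[OF borel_measurable_PiM_sum_squares]) simp
  qed
  have F'_measure: "measure (P n) (F n) - 2 / (9 * real n) \<le> measure (P n) (F' n) \<and> measure (P n) (F' n) \<le> 1"
    if n: "n \<ge> 1" for n
  proof -
    obtain \<mu> q where "standardized \<mu> q" and P: "P n = (\<Pi>\<^sub>M i\<in>{..<n}. \<mu>)"
      using law[OF n] by blast
    then interpret standardized \<mu> q by simp
    interpret P: prob_space "P n"
      unfolding P by (rule prob_space_PiM_power)
    have compl: "space (P n) - G n = {u \<in> space (P n). (\<Sum>i<n. (u i)\<^sup>2) > 4 * real n}"
      by (auto simp: G_def)
    \<comment> \<open>A union bound: restricting the assumed event to \<open>G n\<close> costs at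
      most 2 / (9 n), which tends to 0.\<close>
    have "measure (P n) (F n) \<le> measure (P n) (F n \<inter> G n \<union> (space (P n) - G n))"
      using F_sets G_sets[OF n] sets.sets_into_space[OF F_sets, of n]
      by (intro P.finite_measure_mono) auto
    also have "\<dots> \<le> measure (P n) (F n \<inter> G n) + measure (P n) (space (P n) - G n)"
      using F_sets G_sets[OF n] by (intro measure_Un_le) auto
    also have "measure (P n) (space (P n) - G n) \<le> 2 / (9 * real n)"
      unfolding compl unfolding P by (rule prob_sum_squares_gt_le[OF n])
    finally show ?thesis
      using n by (simp add: F'_def)
  qed
  have "(\<lambda>n. measure (P n) (F' n)) \<longlonglongrightarrow> 1"
  proof (rule tendsto_sandwich)
    have "(\<lambda>n. 2 / (9 * real n)) \<longlonglongrightarrow> 0"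
      using lim_const_over_n[of "2 / 9 :: real"] by simp
    from tendsto_diff[OF F_lim this]
    show "(\<lambda>n. measure (P n) (F n) - 2 / (9 * real n)) \<longlonglongrightarrow> 1"
      by simp
    show "(\<lambda>_. 1 :: real) \<longlonglongrightarrow> 1"
      by (rule tendsto_const)
    show "\<forall>\<^sub>F n in sequentially. measure (P n) (F n) - 2 / (9 * real n) \<le> measure (P n) (F' n)"
      and "\<forall>\<^sub>F n in sequentially. measure (P n) (F' n) \<le> 1"
      using F'_measure by (auto simp: eventually_sequentially)
  qed
  moreover have "F' n \<in> sets (P n)" for n
    using F_sets G_sets[of n] by (auto simp: F'_def)
  moreover have "spectral_norm
          (A n - lin_comb (m n) n (p n) (\<lambda>j. recovered_coeffs (m n) n (p n) (B n) (A n) u $ j) (B n))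
          \<le> 3 * \<epsilon> n * \<Lambda> n * sqrt (\<kappa> n * real (p n) / (1 - t n))"
    if u: "u \<in> F' n" for n u
  proof -
    \<comment> \<open>Since \<open>F' 0\<close> is empty, the mere existence of u gives n >= 1,
      where the hypotheses apply.\<close>
    have n: "n \<ge> 1" and uF: "u \<in> F n" and uG: "u \<in> G n"
      using u by (auto simp: F'_def split: if_splits)
    have B: "\<And>j. j < p n \<Longrightarrow> B n j \<in> carrier_mat (m n) n"
      using * n by blast
    obtain \<mu> q where "standardized \<mu> q" and P: "P n = (\<Pi>\<^sub>M i\<in>{..<n}. \<mu>)"
      using law[OF n] by blast
    then interpret standardized \<mu> q by simp
    have N: "N n = gram_matrix (p n) (B n)"
      using * n expected_query_gram[of "p n" "B n" "m n" n, OF B] by (simp add: P)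
    show ?thesis
      using * n F[OF uF] uG recovery_error_bound[of n "p n" "B n" "m n" "\<kappa> n" "E n" "\<epsilon> n" "A n" "d n" "t n" u]
      by (simp add: N G_def)
  qed
  ultimately show "with_high_probability P (\<lambda>n u.
        spectral_norm
          (A n - lin_comb (m n) n (p n) (\<lambda>j. recovered_coeffs (m n) n (p n) (B n) (A n) u $ j) (B n))
          \<le> 3 * \<epsilon> n * \<Lambda> n * sqrt (\<kappa> n * real (p n) / (1 - t n)))"
    unfolding with_high_probability_def by blast
qed simp

end
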